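(* If $\mathcal{U}$ is a basically generated ultrafilter on $\omega$, then $(\mathcal{U},\supseteq)<_T([\mathfrak{c}]^{<\omega},\subseteq)$.
   Context: For directed partial orders $D,E$, $D\le_T E$ (Tukey reducibility) means there is a map $f:E\to D$ sending every cofinal subset of $E$ to a cofinal subset of $D$ (equivalently, a map $g:D\to E$ sending unbounded subsets of $D$ to unbounded subsets of $E$); $D<_T E$ means $D\le_T E$ but not $E\le_T D$. $[\mathfrak{c}]^{<\omega}$ is the set of finite subsets of the continuum $\mathfrak{c}$, ordered by inclusion. An ultrafilter $\mathcal{U}$ on $\omega$ is basically generated if it has a filter base $\mathcal{B}\subseteq\mathcal{U}$ such that every sequence $(A_n)\subseteq\mathcal{B}$ converging in the Cantor topology on $\mathcal{P}(\omega)$ to an element of $\mathcal{B}$ has a subsequence $(A_{n_k})$ with $\bigcap_k A_{n_k}\in\mathcal{U}$. *)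

theory Defs
  imports "HOL-Analysis.Analysis"
begin

text \<open>An order is given by a carrier together with a relation whose second argument is the
  larger one; only its values on the carrier matter.  For an ultrafilter \<open>U\<close> ordered by
  \<open>(\<supseteq>)\<close>, larger therefore means smaller as a set.\<close>

definition directed_poset :: "'a set \<Rightarrow> ('a \<Rightarrow> 'a \<Rightarrow> bool) \<Rightarrow> bool" where
  "directed_poset D le \<longleftrightarrow>
     partial_order_on D {(x, y). x \<in> D \<and> y \<in> D \<and> le x y} \<and>
     D \<noteq> {} \<and> (\<forall>x\<in>D. \<forall>y\<in>D. \<exists>z\<in>D. le x z \<and> le y z)"

definition cofinal_in :: "'a set \<Rightarrow> ('a \<Rightarrow> 'a \<Rightarrow> bool) \<Rightarrow> 'a set \<Rightarrow> bool" where
  "cofinal_in D le X \<longleftrightarrow> X \<subseteq> D \<and> (\<forall>d\<in>D. \<exists>x\<in>X. le d x)"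

definition unbounded_in :: "'a set \<Rightarrow> ('a \<Rightarrow> 'a \<Rightarrow> bool) \<Rightarrow> 'a set \<Rightarrow> bool" where
  "unbounded_in D le X \<longleftrightarrow> X \<subseteq> D \<and> \<not> (\<exists>d\<in>D. \<forall>x\<in>X. le x d)"

definition tukey_le ::
  "'a set \<Rightarrow> ('a \<Rightarrow> 'a \<Rightarrow> bool) \<Rightarrow> 'b set \<Rightarrow> ('b \<Rightarrow> 'b \<Rightarrow> bool) \<Rightarrow> bool" where
  "tukey_le D leD E leE \<longleftrightarrow>
     (\<exists>f \<in> E \<rightarrow> D. \<forall>X. cofinal_in E leE X \<longrightarrow> cofinal_in D leD (f ` X))"

definition tukey_less ::
  "'a set \<Rightarrow> ('a \<Rightarrow> 'a \<Rightarrow> bool) \<Rightarrow> 'b set \<Rightarrow> ('b \<Rightarrow> 'b \<Rightarrow> bool) \<Rightarrow> bool" where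
  "tukey_less D leD E leE \<longleftrightarrow> tukey_le D leD E leE \<and> \<not> tukey_le E leE D leD"

definition ultrafilter :: "'a set set \<Rightarrow> bool" where
  "ultrafilter U \<longleftrightarrow>
     UNIV \<in> U \<and> {} \<notin> U \<and>
     (\<forall>A\<in>U. \<forall>B. A \<subseteq> B \<longrightarrow> B \<in> U) \<and>
     (\<forall>A\<in>U. \<forall>B\<in>U. A \<inter> B \<in> U) \<and>
     (\<forall>A. A \<in> U \<or> - A \<in> U)"

definition filter_base_of :: "'a set set \<Rightarrow> 'a set set \<Rightarrow> bool" where
  "filter_base_of B U \<longleftrightarrow> B \<subseteq> U \<and> (\<forall>A\<in>U. \<exists>C\<in>B. C \<subseteq> A)"

text \<open>Subsets of \<open>nat\<close> are identified with their characteristic functions, so that the limit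
  is taken in the product topology on \<open>nat \<Rightarrow> bool\<close> with \<open>bool\<close> discrete.\<close>

definition cantor_converges :: "(nat \<Rightarrow> nat set) \<Rightarrow> nat set \<Rightarrow> bool" where
  "cantor_converges A L \<longleftrightarrow> (\<lambda>n. \<lambda>i. i \<in> A n) \<longlonglongrightarrow> (\<lambda>i. i \<in> L)"

definition basically_generated :: "nat set set \<Rightarrow> bool" where
  "basically_generated U \<longleftrightarrow>
     (\<exists>B. filter_base_of B U \<and>
        (\<forall>A L. range A \<subseteq> B \<longrightarrow> L \<in> B \<longrightarrow> cantor_converges A L \<longrightarrow>
           (\<exists>k :: nat \<Rightarrow> nat. strict_mono k \<and> (\<Inter>n. A (k n)) \<in> U)))"

lemma directed_poset_ultrafilter:
  assumes "ultrafilter U"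
  shows "directed_poset U (\<supseteq>)"
proof -
  have "\<exists>C\<in>U. C \<subseteq> A \<and> C \<subseteq> B" if "A \<in> U" "B \<in> U" for A B
    using assms that unfolding ultrafilter_def by (meson inf_le1 inf_le2)
  moreover have "U \<noteq> {}"
    using assms unfolding ultrafilter_def by blast
  ultimately show ?thesis
    by (auto simp: directed_poset_def partial_order_on_def preorder_on_def refl_on_def
        trans_def antisym_def)
qed

lemma directed_poset_Fpow: "directed_poset (Fpow K) (\<subseteq>)"
proof -
  have "\<exists>H\<in>Fpow K. F \<subseteq> H \<and> G \<subseteq> H" if "F \<in> Fpow K" "G \<in> Fpow K" for F G
    using that by (intro bexI[of _ "F \<union> G"]) (auto simp: Fpow_def)
  moreover have "Fpow K \<noteq> {}"
    by (auto simp: Fpow_def)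
  ultimately show ?thesis
    by (auto simp: directed_poset_def partial_order_on_def preorder_on_def refl_on_def
        trans_def antisym_def)
qed

lemma tukey_le_iff_unbounded_map:
  assumes D: "directed_poset D leD" and E: "directed_poset E leE"
  shows "tukey_le D leD E leE \<longleftrightarrow>
    (\<exists>g \<in> D \<rightarrow> E. \<forall>X. unbounded_in D leD X \<longrightarrow> unbounded_in E leE (g ` X))"
    (is "?L \<longleftrightarrow> ?R")
proof
  assume ?L
  then obtain f where f: "f \<in> E \<rightarrow> D"
    and cof: "\<And>X. cofinal_in E leE X \<Longrightarrow> cofinal_in D leD (f ` X)"
    unfolding tukey_le_def by blast
  have "\<exists>e\<in>E. \<forall>e'\<in>E. leE e e' \<longrightarrow> leD d (f e')" if d: "d \<in> D" for d
  proof (rule ccontr)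
    assume "\<not> ?thesis"
    then have "cofinal_in E leE {e'\<in>E. \<not> leD d (f e')}"
      unfolding cofinal_in_def by blast
    from cof[OF this] d show False
      unfolding cofinal_in_def by auto
  qed
  then obtain g where g: "\<And>d. d \<in> D \<Longrightarrow> g d \<in> E"
    and gf: "\<And>d e'. d \<in> D \<Longrightarrow> e' \<in> E \<Longrightarrow> leE (g d) e' \<Longrightarrow> leD d (f e')"
    by metis
  have "unbounded_in E leE (g ` X)" if X: "unbounded_in D leD X" for X
    unfolding unbounded_in_def
  proof (intro conjI notI)
    show "g ` X \<subseteq> E"
      using X g unfolding unbounded_in_def by blast
    assume "\<exists>e\<in>E. \<forall>y\<in>g ` X. leE y e"
    then obtain e where "e \<in> E" "\<forall>x\<in>X. leE (g x) e" by auto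
    with gf X have "\<forall>x\<in>X. leD x (f e)"
      unfolding unbounded_in_def by blast
    with X f \<open>e \<in> E\<close> show False
      unfolding unbounded_in_def by blast
  qed
  with g show ?R by (intro bexI[of _ g]) auto
next
  assume ?R
  then obtain g where g: "g \<in> D \<rightarrow> E"
    and unb: "\<And>X. unbounded_in D leD X \<Longrightarrow> unbounded_in E leE (g ` X)" by blast
  have "\<exists>d\<in>D. \<forall>x\<in>D. leE (g x) e \<longrightarrow> leD x d" if "e \<in> E" for e
  proof (rule ccontr)
    assume "\<not> ?thesis"
    then have "unbounded_in D leD {x\<in>D. leE (g x) e}"
      unfolding unbounded_in_def by blast
    from unb[OF this] that show False
      unfolding unbounded_in_def by auto
  qed
  then obtain f where f: "\<And>e. e \<in> E \<Longrightarrow> f e \<in> D"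
    and gf: "\<And>e x. e \<in> E \<Longrightarrow> x \<in> D \<Longrightarrow> leE (g x) e \<Longrightarrow> leD x (f e)"
    by metis
  have "cofinal_in D leD (f ` X)" if X: "cofinal_in E leE X" for X
    unfolding cofinal_in_def
  proof (intro conjI ballI)
    show "f ` X \<subseteq> D"
      using X f unfolding cofinal_in_def by blast
    fix d assume d: "d \<in> D"
    with g have "g d \<in> E" by blast
    with X obtain x where "x \<in> X" "x \<in> E" "leE (g d) x"
      unfolding cofinal_in_def by blast
    with gf d show "\<exists>y\<in>f ` X. leD d y" by blast
  qed
  with f show ?L
    unfolding tukey_le_def by (intro bexI[of _ f]) auto
qed

end

theory Submission
  imports Defs
begin

text \<open>A Tukey map from \<open>[\<cc>]\<^bsup><\<omega>\<^esup>\<close> to \<open>U\<close> would give continuum many members of \<open>U\<close>,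
  without loss of generality of the base, no infinitely many of which have their intersection
  in \<open>U\<close>.  As the Cantor space is second countable, one of these members is a limit of others,
  and basic generation yields an infinite subfamily with intersection in \<open>U\<close>.  Conversely,
  any injection of \<open>U\<close> into \<open>\<cc>\<close> sends unbounded sets, which are infinite, to unbounded ones.\<close>

lemma cantor_convergesI:
  assumes "\<And>n. A n \<inter> {..<n} = L \<inter> {..<n}"
  shows "cantor_converges A L"
proof -
  have "\<forall>\<^sub>F n in sequentially. (i \<in> A n) = (i \<in> L)" for i
    using eventually_gt_at_top[of i] by eventually_elim (use assms in blast)
  then have "(\<lambda>n. i \<in> A n) \<longlonglongrightarrow> (i \<in> L)" for i
    by (rule tendsto_eventually)
  \<comment> \<open>The class topology on functions is rewritten as a product topology, where limits
    are taken coordinatewise; coordinate \<open>i\<close> is constant as soon as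
    \<open>n > i\<close>.\<close>
  then show ?thesis
    unfolding cantor_converges_def limitin_canonical_iff[symmetric] euclidean_product_topology[symmetric]
      limitin_componentwise
    by simp
qed

text \<open>If no member were a limit of others, each \<open>L\<close> would be isolated in
  \<open>S\<close> by some initial segment of length \<open>m L\<close>. The pair of
  \<open>m L\<close> and the trace of \<open>L\<close> on that segment would then determine
  \<open>L\<close>, and there are only countably many such pairs.\<close>

lemma uncountable_set_family_limit:
  fixes S :: "nat set set"
  assumes "uncountable S"
  obtains L A where "L \<in> S" "\<And>n. A n \<in> S" "\<And>n. A n \<noteq> L" "\<And>n. A n \<inter> {..<n} = L \<inter> {..<n}"
proof -
  have "\<exists>L\<in>S. \<forall>n. \<exists>C\<in>S. C \<noteq> L \<and> C \<inter> {..<n} = L \<inter> {..<n}"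
  proof (rule ccontr)
    assume "\<not> ?thesis"
    then obtain m where m: "\<And>L C. L \<in> S \<Longrightarrow> C \<in> S \<Longrightarrow> C \<inter> {..<m L} = L \<inter> {..<m L} \<Longrightarrow> C = L"
      by metis
    have "inj_on (\<lambda>L. (m L, L \<inter> {..<m L})) S"
      by (intro inj_onI) (metis m prod.inject)
    moreover have "(\<lambda>L. (m L, L \<inter> {..<m L})) ` S \<subseteq> UNIV \<times> {F. finite F}"
      by auto
    moreover have "countable ((UNIV :: nat set) \<times> {F :: nat set. finite F})"
      using countable_Collect_finite by blast
    ultimately show False
      using assms countable_image_inj_on countable_subset by blast
  qed
  then show thesis
    using that by metis
qed

text \<open>With finite range, some value would recur at arbitrarily large indices, hence agree with
  \<open>L\<close> on every initial segment and equal \<open>L\<close>, which is excluded.\<close>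

lemma limit_sequence_infinite_range:
  fixes k :: "nat \<Rightarrow> nat"
  assumes "\<And>n. A n \<noteq> L" "\<And>n. A n \<inter> {..<n} = L \<inter> {..<n}" "strict_mono k"
  shows "infinite (range (A \<circ> k))"
proof
  assume "finite (range (A \<circ> k))"
  then obtain n where n: "infinite {m. (A \<circ> k) m = (A \<circ> k) n}"
    using pigeonhole_infinite[of UNIV "A \<circ> k"] by auto
  have "i \<in> A (k n) \<longleftrightarrow> i \<in> L" for i
  proof -
    obtain m where "m > i" "A (k m) = A (k n)"
      using n unfolding infinite_nat_iff_unbounded by auto
    moreover have "m \<le> k m"
      using assms(3) by (rule strict_mono_imp_increasing)
    ultimately show ?thesis
      using assms(2)[of "k m"] by (metis Int_iff lessThan_iff less_le_trans)
  qed
  then show False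
    using assms(1) by blast
qed

lemma ultrafilter_finite_bounded:
  assumes U: "ultrafilter U" and X: "finite X" "X \<subseteq> U"
  shows "\<Inter>X \<in> U"
  using X by (induction X) (use U in \<open>auto simp: ultrafilter_def\<close>)

lemma tukey_le_Fpow:
  assumes U: "ultrafilter U" and h: "inj_on h U" "h ` U \<subseteq> K"
  shows "tukey_le U (\<supseteq>) (Fpow K) (\<subseteq>)"
  unfolding tukey_le_iff_unbounded_map[OF directed_poset_ultrafilter[OF U] directed_poset_Fpow]
proof (intro bexI[of _ "\<lambda>A. {h A}"] allI impI)
  show "(\<lambda>A. {h A}) \<in> U \<rightarrow> Fpow K"
    using h by (auto simp: Fpow_def)
  fix X assume X: "unbounded_in U (\<supseteq>) X"
  \<comment> \<open>An upper bound \<open>F\<close> of the singletons contains the image of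
    \<open>X\<close> under \<open>h\<close>, so injectivity makes \<open>X\<close> finite, and then
    its intersection bounds it in \<open>U\<close>.\<close>
  have "\<not> (\<exists>F\<in>Fpow K. \<forall>x\<in>X. h x \<in> F)"
  proof
    assume "\<exists>F\<in>Fpow K. \<forall>x\<in>X. h x \<in> F"
    then obtain F where F: "F \<in> Fpow K" "\<forall>x\<in>X. h x \<in> F" by blast
    then have "h ` X \<subseteq> F" "finite F"
      by (auto simp: Fpow_def)
    then have "finite X"
      using X h(1) unfolding unbounded_in_def by (meson finite_imageD finite_subset inj_on_subset)
    then have "\<Inter>X \<in> U"
      using X U ultrafilter_finite_bounded unfolding unbounded_in_def by blast
    then show False
      using X unfolding unbounded_in_def by blast
  qed
  then show "unbounded_in (Fpow K) (\<subseteq>) ((\<lambda>A. {h A}) ` X)"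
    using X h(2) unfolding unbounded_in_def by (simp add: Fpow_def) blast
qed

lemma not_Fpow_tukey_le:
  assumes U: "ultrafilter U" and "basically_generated U" and K: "uncountable K"
  shows "\<not> tukey_le (Fpow K) (\<subseteq>) U (\<supseteq>)"
proof
  assume "tukey_le (Fpow K) (\<subseteq>) U (\<supseteq>)"
  then obtain g where g: "g \<in> Fpow K \<rightarrow> U"
    and unb: "\<And>X. unbounded_in (Fpow K) (\<subseteq>) X \<Longrightarrow> unbounded_in U (\<supseteq>) (g ` X)"
    unfolding tukey_le_iff_unbounded_map[OF directed_poset_Fpow directed_poset_ultrafilter[OF U]]
    by blast
  from assms(2) obtain B where B: "filter_base_of B U"
    and lim: "\<And>A L. range A \<subseteq> B \<Longrightarrow> L \<in> B \<Longrightarrow> cantor_converges A L \<Longrightarrow>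
           (\<exists>k :: nat \<Rightarrow> nat. strict_mono k \<and> (\<Inter>n. A (k n)) \<in> U)"
    unfolding basically_generated_def by blast
  \<comment> \<open>Basic generation speaks only of sequences in \<open>B\<close>, so each
    \<open>g {x}\<close> is shrunk to a base element \<open>b x\<close>; this only makes common
    bounds harder to find.\<close>
  have "\<exists>c\<in>B. c \<subseteq> g {x}" if "x \<in> K" for x
  proof -
    have "{x} \<in> Fpow K"
      using that by (simp add: Fpow_def)
    with g B show ?thesis
      unfolding filter_base_of_def by blast
  qed
  then obtain b where bB: "\<And>x. x \<in> K \<Longrightarrow> b x \<in> B" and bg: "\<And>x. x \<in> K \<Longrightarrow> b x \<subseteq> g {x}"
    by metis
  \<comment> \<open>The singletons of an infinite \<open>I\<close> have no finite upper bound, so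
    their images under \<open>g\<close> have no common subset in \<open>U\<close>.\<close>
  have fin: "finite I" if I: "I \<subseteq> K" and V: "V \<in> U" "\<And>x. x \<in> I \<Longrightarrow> V \<subseteq> b x" for I V
  proof (rule ccontr)
    assume "infinite I"
    then have "\<not> (\<exists>F\<in>Fpow K. I \<subseteq> F)"
      by (auto simp: Fpow_def dest: finite_subset)
    then have "unbounded_in (Fpow K) (\<subseteq>) ((\<lambda>x. {x}) ` I)"
      using I by (simp add: unbounded_in_def Fpow_def) blast
    from unb[OF this] V(1) obtain x where "x \<in> I" "\<not> V \<subseteq> g {x}"
      unfolding unbounded_in_def by blast
    with V(2) bg I show False
      by blast
  qed
  \<comment> \<open>\<open>b\<close> may fail to be injective, but \<open>c\<close> itself is a
    common bound over its fibre. Finite fibres over the uncountable \<open>K\<close> force an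
    uncountable image.\<close>
  have "finite {x \<in> K. b x = c}" if "c \<in> b ` K" for c
    using that bB B by (intro fin[of _ c]) (auto simp: filter_base_of_def)
  then have "countable (\<Union>c\<in>b ` K. {x \<in> K. b x = c})" if "countable (b ` K)"
    by (intro countable_UN[OF that] countable_finite)
  moreover have "(\<Union>c\<in>b ` K. {x \<in> K. b x = c}) = K"
    by blast
  ultimately have "uncountable (b ` K)"
    using K by metis
  then obtain L A where L: "L \<in> b ` K" and A: "\<And>n. A n \<in> b ` K" "\<And>n. A n \<noteq> L"
      "\<And>n. A n \<inter> {..<n} = L \<inter> {..<n}"
    by (rule uncountable_set_family_limit) blast
  have bKB: "b ` K \<subseteq> B"
    using bB by blast
  have "L \<in> B"
    using bKB L by (rule subsetD)
  have "range A \<subseteq> B"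
    using bKB A(1) by (intro image_subsetI) (rule subsetD)
  from lim[OF this \<open>L \<in> B\<close> cantor_convergesI[OF A(3)]]
  obtain k :: "nat \<Rightarrow> nat" where k: "strict_mono k" "(\<Inter>n. A (k n)) \<in> U"
    by blast
  \<comment> \<open>The intersection of the subsequence lies in \<open>U\<close> and is contained in
    each of these \<open>b x\<close>.\<close>
  have "finite {x \<in> K. b x \<in> range (A \<circ> k)}"
    by (rule fin[OF _ k(2)]) auto
  moreover have "range (A \<circ> k) \<subseteq> b ` {x \<in> K. b x \<in> range (A \<circ> k)}"
  proof
    fix c assume c: "c \<in> range (A \<circ> k)"
    then have "c \<in> b ` K"
      using A(1) by auto
    with c show "c \<in> b ` {x \<in> K. b x \<in> range (A \<circ> k)}"
      by blast
  qed
  ultimately have "finite (range (A \<circ> k))"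
    using finite_surj by blast
  with limit_sequence_infinite_range[OF A(2,3) k(1)] show False
    by blast
qed

theorem theorem18:
  fixes U :: "nat set set" and K :: "'c set"
  assumes "ultrafilter U"
    and "basically_generated U"
    and "K \<approx> (UNIV :: real set)"
  shows "tukey_less U (\<supseteq>) (Fpow K) (\<subseteq>)"
proof -
  have "U \<lesssim> (UNIV :: nat set set)"
    by (simp add: subset_imp_lepoll)
  also have "(UNIV :: nat set set) \<approx> (UNIV :: real set)"
    using nat_sets_eqpoll_reals by simp
  also have "(UNIV :: real set) \<approx> K"
    using assms(3) by (rule eqpoll_sym)
  finally obtain h where "inj_on h U" "h ` U \<subseteq> K"
    unfolding lepoll_def by blast
  moreover have "uncountable K"
    using assms(3) uncountable_UNIV_real by (metis countable_eqpoll eqpoll_sym)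
  ultimately show ?thesis
    unfolding tukey_less_def
    by (intro conjI tukey_le_Fpow[OF assms(1)] not_Fpow_tukey_le[OF assms(1,2)])
qed

end
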